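(* Assume $\sigma(A,\cdot)$ can be evaluated exactly. The following algorithm for CostIMA returns a feasible solution $S_{out}$ (i.e. $S_{out}\subseteq (A\times V)\setminus E$, $c(S_{out})\le k$) with $\sigma(A,S_{out})\ge \frac12\left(1-\frac1e\right)\mathrm{OPT}$, where $\mathrm{OPT}$ is the optimal value. Algorithm: let $e_M$ be an edge of $(A\times V)\setminus E$ maximizing $\sigma(A,\{e_M\})$. Run the greedy phase: start with $S=\emptyset$, remaining budget $k$, and $T=(A\times V)\setminus E$; while $T\neq\emptyset$, pick $\hat e\in T$ maximizing $\delta(S\cup\{e\},S)/c_e$; if $c_{\hat e}$ is at most the remaining budget, add $\hat e$ to $S$ and decrease the remaining budget by $c_{\hat e}$; remove $\hat e$ from $T$. Return whichever of $S$ and $\{e_M\}$ has larger $\sigma(A,\cdot)$.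
   Context: A network is a directed graph $G=(V,E)$ with propagation probabilities $p:V\times V\to[0,1]$ and edge-addition costs $c:V\times V\to[0,1]$. Independent Cascade Model: given a seed set $A\subseteq V$, the nodes of $A$ are active initially; each node $u$ that has just become active gets one chance to activate each inactive out-neighbour $v$, succeeding independently with probability $p_{(u,v)}$; the process stops when no new node becomes active. For $S\subseteq (V\times V)\setminus E$, $G(S)=(V,E\cup S)$ and $\sigma(A,S)$ is the expected number of active nodes at the end of the process on $G(S)$ with seeds $A$. For $S_2\subseteq S_1$, $\delta(S_1,S_2)$ is the expected number of nodes reachable from $A$ via live edges in a random live-edge graph of $G(S_1)$ but not reachable once the edges of $S_1\setminus S_2$ are removed (each edge live independently with probability $p_e$). CostIMA (Cost Influence Maximization with Augmentation): given $G,p,c$, a seed set $A\subseteq V$ and a budget $k$, find $S\subseteq (A\times V)\setminus E$ with $c(S)=\sum_{e\in S}c_e\le k$ maximizing $\sigma(A,S)$; $\mathrm{OPT}$ denotes the maximum.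
   Formalization: Assumes k ≥ 0 and that every edge of (A×V)\E costs at most k (automatic if k ≥ 1), since otherwise {e_M} may be infeasible; for zero-cost edges, positive gain/0 is ∞ and 0/0 is 0; if (A×V)\E is empty the greedy set is returned. *)

theory Defs
  imports "HOL-Probability.Probability"
begin

definition network ::
  "'a set \<Rightarrow> ('a \<times> 'a) set \<Rightarrow> ('a \<times> 'a \<Rightarrow> real) \<Rightarrow> ('a \<times> 'a \<Rightarrow> real) \<Rightarrow> bool" where
  "network V E p c \<longleftrightarrow>
     finite V \<and> E \<subseteq> V \<times> V \<and> (\<forall>e \<in> V \<times> V. p e \<in> {0..1}) \<and> (\<forall>e \<in> V \<times> V. c e \<in> {0..1})"

definition live_edges :: "('a \<times> 'a \<Rightarrow> real) \<Rightarrow> ('a \<times> 'a) set \<Rightarrow> ('a \<times> 'a) set pmf" where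
  "live_edges p F = map_pmf (\<lambda>\<omega>. {e \<in> F. \<omega> e}) (Pi_pmf F False (\<lambda>e. bernoulli_pmf (p e)))"

definition attempts :: "('a \<times> 'a) set \<Rightarrow> 'a set \<Rightarrow> 'a set \<Rightarrow> ('a \<times> 'a) set" where
  "attempts F X Y = {(u, v) \<in> F. u \<in> Y \<and> v \<notin> X}"

lemma set_pmf_live_edges_subset:
  assumes "L \<in> set_pmf (live_edges p F)"
  shows "L \<subseteq> F"
  using assms by (auto simp: live_edges_def)

text \<open>Independent Cascade process on the edge set \<open>F\<close>: \<open>X\<close> is the set of all active nodes and
  \<open>Y\<close> the set of those that became active in the last round. The result is the distribution of the
  set of active nodes when the process stops. The guard on infinite edge sets only serves
  termination of the recursion.\<close>

function cascade ::
  "('a \<times> 'a \<Rightarrow> real) \<Rightarrow> ('a \<times> 'a) set \<Rightarrow> 'a set \<Rightarrow> 'a set \<Rightarrow> 'a set pmf" where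
  "cascade p F X Y =
     (if Y = {} \<or> infinite F then return_pmf X
      else bind_pmf (live_edges p (attempts F X Y))
             (\<lambda>L. cascade p F (X \<union> snd ` L) (snd ` L)))"
  by pat_completeness auto
termination
proof (relation "measures [\<lambda>(p, F, X, Y). card (snd ` F - X), \<lambda>(p, F, X, Y). if Y = {} then 0 else 1]",
    goal_cases)
  case 1
  show ?case by simp
next
  case (2 p F X Y L)
  then have fin: "finite F" and Y: "Y \<noteq> {}" by auto
  have L: "L \<subseteq> attempts F X Y" using 2(2) by (rule set_pmf_live_edges_subset)
  show ?case
  proof (cases "L = {}")
    case True
    then show ?thesis using Y by simp
  next
    case False
    then obtain u v where uv: "(u, v) \<in> L" by auto
    then have "(u, v) \<in> F" "v \<notin> X" using L by (auto simp: attempts_def)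
    then have "v \<in> snd ` F - X" "v \<notin> snd ` F - (X \<union> snd ` L)" using uv by force+
    then have "snd ` F - (X \<union> snd ` L) \<subset> snd ` F - X" by blast
    then have "card (snd ` F - (X \<union> snd ` L)) < card (snd ` F - X)"
      using fin by (intro psubset_card_mono) auto
    then show ?thesis by simp
  qed
qed

declare cascade.simps [simp del]

definition \<sigma> ::
  "('a \<times> 'a) set \<Rightarrow> ('a \<times> 'a \<Rightarrow> real) \<Rightarrow> 'a set \<Rightarrow> ('a \<times> 'a) set \<Rightarrow> real" where
  "\<sigma> E p A S = measure_pmf.expectation (cascade p (E \<union> S) A A) (\<lambda>X. real (card X))"

definition \<delta> ::
  "('a \<times> 'a) set \<Rightarrow> ('a \<times> 'a \<Rightarrow> real) \<Rightarrow> 'a set \<Rightarrow> ('a \<times> 'a) set \<Rightarrow> ('a \<times> 'a) set \<Rightarrow> real" where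
  "\<delta> E p A S1 S2 =
     measure_pmf.expectation (live_edges p (E \<union> S1))
       (\<lambda>L. real (card (L\<^sup>* `` A - (L - (S1 - S2))\<^sup>* `` A)))"

definition candidates :: "'a set \<Rightarrow> ('a \<times> 'a) set \<Rightarrow> 'a set \<Rightarrow> ('a \<times> 'a) set" where
  "candidates V E A = A \<times> V - E"

definition feasible ::
  "'a set \<Rightarrow> ('a \<times> 'a) set \<Rightarrow> ('a \<times> 'a \<Rightarrow> real) \<Rightarrow> 'a set \<Rightarrow> real \<Rightarrow> ('a \<times> 'a) set \<Rightarrow> bool" where
  "feasible V E c A k S \<longleftrightarrow> S \<subseteq> candidates V E A \<and> sum c S \<le> k"

definition OPT ::
  "'a set \<Rightarrow> ('a \<times> 'a) set \<Rightarrow> ('a \<times> 'a \<Rightarrow> real) \<Rightarrow> ('a \<times> 'a \<Rightarrow> real) \<Rightarrow> 'a set \<Rightarrow> real \<Rightarrow> real" where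
  "OPT V E p c A k = Max (\<sigma> E p A ` {S. feasible V E c A k S})"

text \<open>Costs may be zero, so the ratio is taken in the extended reals, where a positive gain
  divided by cost \<open>0\<close> is \<open>\<infinity>\<close> (and \<open>0 / 0 = 0\<close>); on type \<open>real\<close> it would be \<open>0\<close>.\<close>

definition gain_ratio ::
  "('a \<times> 'a) set \<Rightarrow> ('a \<times> 'a \<Rightarrow> real) \<Rightarrow> ('a \<times> 'a \<Rightarrow> real) \<Rightarrow> 'a set \<Rightarrow> ('a \<times> 'a) set
    \<Rightarrow> 'a \<times> 'a \<Rightarrow> ereal" where
  "gain_ratio E p c A S e = ereal (\<delta> E p A (S \<union> {e}) S) / ereal (c e)"

text \<open>\<open>greedy E p c A S b T R\<close>: the greedy loop, entered with solution \<open>S\<close>, remaining budget \<open>b\<close>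
  and remaining edges \<open>T\<close>, can end with solution \<open>R\<close>. Ties in the choice of an edge are broken
  arbitrarily, hence a relation.\<close>

inductive greedy ::
  "('a \<times> 'a) set \<Rightarrow> ('a \<times> 'a \<Rightarrow> real) \<Rightarrow> ('a \<times> 'a \<Rightarrow> real) \<Rightarrow> 'a set \<Rightarrow>
   ('a \<times> 'a) set \<Rightarrow> real \<Rightarrow> ('a \<times> 'a) set \<Rightarrow> ('a \<times> 'a) set \<Rightarrow> bool"
  for E p c A where
  finish: "greedy E p c A S b {} S"
| add: "is_arg_max (gain_ratio E p c A S) (\<lambda>e. e \<in> T) e \<Longrightarrow> c e \<le> b \<Longrightarrow>
    greedy E p c A (S \<union> {e}) (b - c e) (T - {e}) R \<Longrightarrow> greedy E p c A S b T R"
| skip: "is_arg_max (gain_ratio E p c A S) (\<lambda>e. e \<in> T) e \<Longrightarrow> \<not> c e \<le> b \<Longrightarrow>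
    greedy E p c A S b (T - {e}) R \<Longrightarrow> greedy E p c A S b T R"

text \<open>If there is no candidate edge, \<open>e\<^sub>M\<close> does not exist and the greedy solution is returned.\<close>

definition algorithm_returns ::
  "'a set \<Rightarrow> ('a \<times> 'a) set \<Rightarrow> ('a \<times> 'a \<Rightarrow> real) \<Rightarrow> ('a \<times> 'a \<Rightarrow> real) \<Rightarrow> 'a set \<Rightarrow> real
    \<Rightarrow> ('a \<times> 'a) set \<Rightarrow> bool" where
  "algorithm_returns V E p c A k S\<^sub>o\<^sub>u\<^sub>t \<longleftrightarrow>
     (\<exists>S. greedy E p c A {} k (candidates V E A) S \<and>
        (if candidates V E A = {} then S\<^sub>o\<^sub>u\<^sub>t = S
         else \<exists>e\<^sub>M. is_arg_max (\<lambda>e. \<sigma> E p A {e}) (\<lambda>e. e \<in> candidates V E A) e\<^sub>M \<and>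
                   is_arg_max (\<sigma> E p A) (\<lambda>X. X \<in> {S, {e\<^sub>M}}) S\<^sub>o\<^sub>u\<^sub>t))"

end

theory Submission
  imports Defs
begin

text \<open>Each edge is tried at most once by the cascade, so its coin may be flipped in advance: the
  spread is the expected number of nodes reachable through live edges. All candidate edges start
  in seeds, so for a fixed live-edge outcome the set reached with \<open>S \<union> T\<close> is the union of the sets
  reached with \<open>S\<close> and with \<open>T\<close>. Hence the spread is monotone and submodular, and \<open>\<delta>\<close> is its
  marginal gain. The bound is then the one for budgeted greedy maximisation of such functions:
  up to and including the first optimal edge that exceeds the budget, greedy choices
  reach \<open>1 - 1 / e\<close> of the optimum, and that last edge adds at most the spread of \<open>e\<^sub>M\<close>.\<close>

section \<open>The live-edge description of the cascade\<close>

lemma live_edges_Un: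
  assumes "finite F1" "finite F2" "F1 \<inter> F2 = {}"
  shows "live_edges p (F1 \<union> F2) =
    map_pmf (\<lambda>(L, M). L \<union> M) (pair_pmf (live_edges p F1) (live_edges p F2))"
proof -
  let ?P = "\<lambda>F. Pi_pmf F False (\<lambda>e. bernoulli_pmf (p e))"
  have "live_edges p (F1 \<union> F2) =
      map_pmf (\<lambda>(f, g). {e \<in> F1 \<union> F2. if e \<in> F1 then f e else g e}) (pair_pmf (?P F1) (?P F2))"
    unfolding live_edges_def Pi_pmf_union[OF assms]
    by (simp add: pmf.map_comp o_def case_prod_unfold)
  also have "(\<lambda>(f, g). {e \<in> F1 \<union> F2. if e \<in> F1 then f e else g e}) =
      (\<lambda>(f, g). {e \<in> F1. f e} \<union> {e \<in> F2. g e})"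
    using assms(3) by (auto simp: fun_eq_iff)
  finally show ?thesis
    unfolding live_edges_def pair_map_pmf1 pair_map_pmf2
    by (simp add: pmf.map_comp o_def case_prod_unfold)
qed

text \<open>Revealing the coins inside \<open>G\<close> leaves those outside independent; the
  cascade proof takes \<open>G\<close> to be the edges tried in the current round.\<close>

lemma map_live_edges_Int_Diff:
  assumes "finite F"
  shows "map_pmf (\<lambda>L. (L \<inter> G, L - G)) (live_edges p F) =
    pair_pmf (live_edges p (F \<inter> G)) (live_edges p (F - G))"
proof -
  have "live_edges p F = live_edges p ((F \<inter> G) \<union> (F - G))"
    by (simp add: Int_Diff_Un)
  also have "\<dots> = map_pmf (\<lambda>(L, M). L \<union> M) (pair_pmf (live_edges p (F \<inter> G)) (live_edges p (F - G)))"
    using assms by (intro live_edges_Un) auto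
  finally have "map_pmf (\<lambda>L. (L \<inter> G, L - G)) (live_edges p F) =
      map_pmf (\<lambda>(L, M). ((L \<union> M) \<inter> G, (L \<union> M) - G))
        (pair_pmf (live_edges p (F \<inter> G)) (live_edges p (F - G)))"
    by (simp add: pmf.map_comp o_def case_prod_unfold)
  also have "\<dots> = map_pmf (\<lambda>x. x) (pair_pmf (live_edges p (F \<inter> G)) (live_edges p (F - G)))"
    by (intro map_pmf_cong refl) (auto dest!: set_pmf_live_edges_subset)
  finally show ?thesis by simp
qed

lemma map_live_edges_Int:
  assumes "finite F"
  shows "map_pmf (\<lambda>L. L \<inter> G) (live_edges p F) = live_edges p (F \<inter> G)"
  using arg_cong[OF map_live_edges_Int_Diff[OF assms, of G p], of "map_pmf fst"]
  by (simp add: pmf.map_comp o_def map_fst_pair_pmf)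

lemma map_live_edges_Diff:
  assumes "finite F"
  shows "map_pmf (\<lambda>L. L - G) (live_edges p F) = live_edges p (F - G)"
  using map_live_edges_Int[OF assms, of "- G" p] by (simp add: Diff_eq)

lemma finite_set_pmf_live_edges:
  assumes "finite F"
  shows "finite (set_pmf (live_edges p F))"
  by (rule finite_subset[of _ "Pow F"]) (use assms in \<open>auto dest!: set_pmf_live_edges_subset\<close>)

lemma Image_rtrancl_subset:
  assumes "Y \<subseteq> Z" "\<And>u v. (u, v) \<in> R \<Longrightarrow> u \<in> Z \<Longrightarrow> v \<in> Z"
  shows "R\<^sup>* `` Y \<subseteq> Z"
proof
  fix z assume "z \<in> R\<^sup>* `` Y"
  then obtain y where "y \<in> Y" "(y, z) \<in> R\<^sup>*" by auto
  from this(2,1) show "z \<in> Z"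
    by (induction rule: rtrancl_induct) (use assms in auto)
qed

text \<open>The edges whose coin can still matter once the nodes \<open>X\<close> are active, of which \<open>Y\<close> are
  new: the coins of edges leaving \<open>X - Y\<close> have already been used.\<close>

definition pending :: "'a set \<Rightarrow> 'a set \<Rightarrow> ('a \<times> 'a) set" where
  "pending X Y = {(u, v). (u \<in> Y \<or> u \<notin> X) \<and> v \<notin> X}"

text \<open>One round peels off a breadth-first layer: live pending edges leaving \<open>Y\<close>
  end in \<open>Y'\<close>, so everything further is reached from \<open>Y'\<close> alone.\<close>

lemma reachable_cascade_step:
  fixes L :: "('a \<times> 'a) set"
  assumes "Y \<subseteq> X"
  defines "Y' \<equiv> snd ` attempts L X Y"
  shows "X \<union> (L \<inter> pending X Y)\<^sup>* `` Y = (X \<union> Y') \<union> (L \<inter> pending (X \<union> Y') Y')\<^sup>* `` Y'"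
    (is "X \<union> ?H\<^sup>* `` Y = _ \<union> ?H'\<^sup>* `` Y'")
proof (rule equalityI)
  let ?Z = "(X \<union> Y') \<union> ?H'\<^sup>* `` Y'"
  have "v \<in> ?Z" if uv: "(u, v) \<in> ?H" and u: "u \<in> ?Z" for u v
  proof (cases "v \<in> X \<union> Y'")
    case False
    then have "u \<notin> Y" using uv by (force simp: Y'_def attempts_def)
    then have "u \<notin> X" using uv by (auto simp: pending_def)
    then have "(u, v) \<in> ?H'" "u \<in> ?H'\<^sup>* `` Y'"
      using False uv u by (auto simp: pending_def)
    then show ?thesis by (blast intro: rtrancl_into_rtrancl)
  qed blast
  then show "X \<union> ?H\<^sup>* `` Y \<subseteq> ?Z"
    using Image_rtrancl_subset[of Y ?Z ?H] assms(1) by blast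
next
  have Y': "Y' \<subseteq> ?H\<^sup>* `` Y"
  proof
    fix v assume "v \<in> Y'"
    then obtain u where "(u, v) \<in> ?H" "u \<in> Y"
      by (auto simp: Y'_def attempts_def pending_def)
    then show "v \<in> ?H\<^sup>* `` Y" by blast
  qed
  \<comment> \<open>Nodes of \<open>Y'\<close> lie outside \<open>X\<close>, so pending edges
    leaving them were pending before the round too.\<close>
  have "Y' \<inter> X = {}" by (auto simp: Y'_def attempts_def)
  then have "?H' \<subseteq> ?H" by (auto simp: pending_def)
  then have "?H'\<^sup>* `` Y' \<subseteq> ?H\<^sup>* `` Y"
    using Y' by (intro Image_rtrancl_subset) (blast intro: rtrancl_into_rtrancl)+
  then show "(X \<union> Y') \<union> ?H'\<^sup>* `` Y' \<subseteq> X \<union> ?H\<^sup>* `` Y"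
    using Y' by blast
qed

text \<open>Induction over the rounds by deferred decisions: later rounds do not look at coins
  already flipped, so flipping all coins in advance gives the same law.\<close>

lemma cascade_eq_live_edges:
  assumes "finite F" "Y \<subseteq> X"
  shows "cascade p F X Y = map_pmf (\<lambda>L. X \<union> (L \<inter> pending X Y)\<^sup>* `` Y) (live_edges p F)"
  using assms
proof (induction p F X Y rule: cascade.induct)
  case (1 p F X Y)
  show ?case
  proof (cases "Y = {}")
    case True
    then show ?thesis by (simp add: cascade.simps)
  next
    case False
    define att where "att = attempts F X Y"
    define next_active where "next_active = (\<lambda>(D :: ('a \<times> 'a) set, M :: ('a \<times> 'a) set).
      (X \<union> snd ` D) \<union> (M \<inter> pending (X \<union> snd ` D) (snd ` D))\<^sup>* `` (snd ` D))"
    have att: "att \<subseteq> F" by (auto simp: att_def attempts_def)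
    \<comment> \<open>Tried edges leave nodes of \<open>Y\<close>, which lie in \<open>X\<close> and
      so are not newly activated in this round.\<close>
    have unused: "pending (X \<union> snd ` D) (snd ` D) \<inter> att = {}" if "D \<subseteq> att" for D
      using that 1(3) by (fastforce simp: pending_def att_def attempts_def)
    have IH: "cascade p F (X \<union> snd ` D) (snd ` D) =
        map_pmf (\<lambda>M. next_active (D, M)) (live_edges p (F - att))"
      if D: "D \<in> set_pmf (live_edges p att)" for D
    proof -
      have "D \<subseteq> att" using D by (rule set_pmf_live_edges_subset)
      have "cascade p F (X \<union> snd ` D) (snd ` D) = map_pmf (\<lambda>L. next_active (D, L)) (live_edges p F)"
        using 1(1)[of D] D False 1(2) by (simp add: att_def next_active_def)
      \<comment> \<open>The induction hypothesis draws coins for all of \<open>F\<close>; once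
        \<open>att\<close> is ignored, the draw concerns only \<open>F - att\<close> and can be
        merged with the draw of this round.\<close>
      also have "(\<lambda>L. next_active (D, L)) = (\<lambda>L. next_active (D, L - att))"
      proof
        fix L
        have "L \<inter> pending (X \<union> snd ` D) (snd ` D) = (L - att) \<inter> pending (X \<union> snd ` D) (snd ` D)"
          using unused[OF \<open>D \<subseteq> att\<close>] by blast
        then show "next_active (D, L) = next_active (D, L - att)"
          by (simp add: next_active_def)
      qed
      also have "map_pmf (\<lambda>L. next_active (D, L - att)) (live_edges p F) =
          map_pmf (\<lambda>M. next_active (D, M)) (map_pmf (\<lambda>L. L - att) (live_edges p F))"
        by (simp add: pmf.map_comp o_def)
      finally show ?thesis by (simp add: map_live_edges_Diff[OF 1(2)])
    qed
    have "cascade p F X Y =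
        bind_pmf (live_edges p att) (\<lambda>D. map_pmf (\<lambda>M. next_active (D, M)) (live_edges p (F - att)))"
      using False 1(2) by (subst cascade.simps) (auto simp: att_def[symmetric] IH intro!: bind_pmf_cong)
    also have "\<dots> = map_pmf next_active (pair_pmf (live_edges p (F \<inter> att)) (live_edges p (F - att)))"
      using att by (simp add: pair_pmf_def map_bind_pmf map_pmf_def bind_assoc_pmf bind_return_pmf
          Int_absorb1)
    also have "\<dots> = map_pmf (\<lambda>L. next_active (L \<inter> att, L - att)) (live_edges p F)"
      by (simp add: map_live_edges_Int_Diff[OF 1(2), symmetric] pmf.map_comp o_def)
    also have "\<dots> = map_pmf (\<lambda>L. X \<union> (L \<inter> pending X Y)\<^sup>* `` Y) (live_edges p F)"
    proof (intro map_pmf_cong refl)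
      fix L assume "L \<in> set_pmf (live_edges p F)"
      then have "L \<subseteq> F" by (rule set_pmf_live_edges_subset)
      define D where "D = attempts L X Y"
      have "L \<inter> att = D" using \<open>L \<subseteq> F\<close> by (auto simp: D_def att_def attempts_def)
      moreover have "(L - att) \<inter> pending (X \<union> snd ` D) (snd ` D) = L \<inter> pending (X \<union> snd ` D) (snd ` D)"
        using unused[of D] \<open>L \<inter> att = D\<close> by blast
      ultimately show "next_active (L \<inter> att, L - att) = X \<union> (L \<inter> pending X Y)\<^sup>* `` Y"
        using reachable_cascade_step[OF 1(3), of L] by (simp add: next_active_def D_def)
    qed
    finally show ?thesis .
  qed
qed

text \<open>With every seed new, \<open>pending A A\<close> drops just the edges into
  \<open>A\<close>, and these add nothing to what is reachable from \<open>A\<close>.\<close>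

lemma \<sigma>_eq_expectation_reachable:
  assumes "finite (E \<union> S)"
  shows "\<sigma> E p A S =
    measure_pmf.expectation (live_edges p (E \<union> S)) (\<lambda>L. real (card (L\<^sup>* `` A)))"
proof -
  have "A \<union> (L \<inter> pending A A)\<^sup>* `` A = L\<^sup>* `` A" (is "?R = _") for L :: "('a \<times> 'a) set"
  proof (rule equalityI)
    show "?R \<subseteq> L\<^sup>* `` A"
      using rtrancl_mono[of "L \<inter> pending A A" L] by blast
    show "L\<^sup>* `` A \<subseteq> ?R"
    proof (rule Image_rtrancl_subset)
      fix u v assume "(u, v) \<in> L" "u \<in> ?R"
      then have "u \<in> (L \<inter> pending A A)\<^sup>* `` A" "v \<in> A \<or> (u, v) \<in> L \<inter> pending A A"
        by (auto simp: pending_def)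
      then show "v \<in> ?R" by (blast intro: rtrancl_into_rtrancl)
    qed blast
  qed
  then show ?thesis
    using assms by (simp add: \<sigma>_def cascade_eq_live_edges)
qed


lemma ex_is_arg_max_if_finite:
  fixes g :: "'a \<Rightarrow> 'b :: linorder"
  assumes "finite S" "S \<noteq> {}"
  shows "\<exists>x. is_arg_max g (\<lambda>x. x \<in> S) x"
proof -
  have "Max (g ` S) \<in> g ` S" using assms by (intro Max_in) auto
  then obtain x where "x \<in> S" "g x = Max (g ` S)" by auto
  then show ?thesis using assms(1) by (auto simp: is_arg_max_linorder intro!: exI[of _ x])
qed

section \<open>The spread as a monotone submodular function\<close>

locale augmentation_instance =
  fixes V :: "'a set" and E :: "('a \<times> 'a) set" and p c :: "'a \<times> 'a \<Rightarrow> real" and A :: "'a set"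
  assumes network: "network V E p c" and seeds: "A \<subseteq> V"
begin

abbreviation C :: "('a \<times> 'a) set" where "C \<equiv> candidates V E A"

abbreviation f :: "('a \<times> 'a) set \<Rightarrow> real" where "f \<equiv> \<sigma> E p A"

text \<open>One outcome \<open>L\<close> serves all choices of \<open>S\<close>, so different
  augmentations can be compared outcome by outcome.\<close>

definition reached :: "('a \<times> 'a) set \<Rightarrow> ('a \<times> 'a) set \<Rightarrow> 'a set" where
  "reached L S = (L \<inter> (E \<union> S))\<^sup>* `` A"

lemma finite_V: "finite V"
  and edges_subset: "E \<union> C \<subseteq> V \<times> V"
  and cost_nonneg: "e \<in> C \<Longrightarrow> 0 \<le> c e"
  using network seeds by (auto simp: network_def candidates_def)

lemma finite_edges: "finite (E \<union> C)" and finite_C: "finite C"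
  using finite_subset[OF edges_subset] finite_V by auto

lemma reached_subset:
  assumes "S \<subseteq> C"
  shows "reached L S \<subseteq> V"
  unfolding reached_def
  by (rule Image_rtrancl_subset) (use assms seeds edges_subset in auto)

lemma finite_reached: "S \<subseteq> C \<Longrightarrow> finite (reached L S)"
  using reached_subset finite_V finite_subset by metis

lemma reached_mono: "S \<subseteq> T \<Longrightarrow> reached L S \<subseteq> reached L T"
  unfolding reached_def by (intro Image_mono rtrancl_mono) auto

text \<open>Candidate edges start in seeds, so a path needs at most one of them, namely its first edge
  after the last visit to \<open>A\<close>; hence the spread is a coverage function.\<close>

lemma reached_Un:
  assumes "S \<subseteq> C" "T \<subseteq> C"
  shows "reached L (S \<union> T) = reached L S \<union> reached L T"
proof (rule equalityI)
  show "reached L (S \<union> T) \<subseteq> reached L S \<union> reached L T"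
    unfolding reached_def[of L "S \<union> T"]
  proof (rule Image_rtrancl_subset)
    show "A \<subseteq> reached L S \<union> reached L T" by (auto simp: reached_def)
    have step: "v \<in> reached L X" if "u \<in> reached L X" "(u, v) \<in> L \<inter> (E \<union> X)" for u v X
      using that unfolding reached_def by (blast intro: rtrancl_into_rtrancl)
    have "u \<in> reached L X" if "u \<in> A" for u X
      using that by (auto simp: reached_def)
    then have tail: "u \<in> reached L S" "u \<in> reached L T" if "(u, v) \<in> S \<union> T" for u v
      using that assms by (auto simp: candidates_def)
    fix u v assume "(u, v) \<in> L \<inter> (E \<union> (S \<union> T))" "u \<in> reached L S \<union> reached L T"
    then show "v \<in> reached L S \<union> reached L T"
      using step tail by blast
  qed
  show "reached L S \<union> reached L T \<subseteq> reached L (S \<union> T)"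
    by (simp add: reached_mono)
qed

section \<open>Spread and gains as expectations over one common probability space\<close>

lemma integrable_live_edges:
  "integrable (measure_pmf (live_edges p (E \<union> C))) (g :: ('a \<times> 'a) set \<Rightarrow> real)"
  by (intro integrable_measure_pmf_finite finite_set_pmf_live_edges finite_edges)

text \<open>Coupling: restricting a draw on \<open>E \<union> C\<close> to
  \<open>E \<union> S\<close> gives the law of a direct draw there.\<close>

lemma expectation_live_edges_subset:
  fixes g :: "('a \<times> 'a) set \<Rightarrow> real"
  assumes "S \<subseteq> C"
  shows "measure_pmf.expectation (live_edges p (E \<union> S)) g =
    measure_pmf.expectation (live_edges p (E \<union> C)) (\<lambda>L. g (L \<inter> (E \<union> S)))"
proof -
  have "(E \<union> C) \<inter> (E \<union> S) = E \<union> S" using assms by blast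
  then have "live_edges p (E \<union> S) = map_pmf (\<lambda>L. L \<inter> (E \<union> S)) (live_edges p (E \<union> C))"
    using map_live_edges_Int[OF finite_edges, of "E \<union> S" p] by simp
  then show ?thesis by simp
qed

lemma spread_eq:
  assumes "S \<subseteq> C"
  shows "f S = measure_pmf.expectation (live_edges p (E \<union> C)) (\<lambda>L. real (card (reached L S)))"
proof -
  have "finite (E \<union> S)" using assms finite_edges finite_subset by (metis Un_mono order_refl)
  then show ?thesis
    by (simp add: \<sigma>_eq_expectation_reachable expectation_live_edges_subset[OF assms] reached_def)
qed

lemma spread_nonneg: "S \<subseteq> C \<Longrightarrow> 0 \<le> f S"
  by (simp add: spread_eq)

lemma spread_mono:
  assumes "S \<subseteq> T" "T \<subseteq> C"
  shows "f S \<le> f T"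
proof -
  have "S \<subseteq> C" using assms by blast
  then show ?thesis
    unfolding spread_eq[OF \<open>S \<subseteq> C\<close>] spread_eq[OF assms(2)]
    by (intro integral_mono integrable_live_edges)
      (use assms in \<open>auto intro!: card_mono finite_reached reached_mono\<close>)
qed

text \<open>Inclusion-exclusion in each outcome: the sets reached with \<open>T\<close> and with
  \<open>S \<union> X\<close> have as union the set reached with \<open>T \<union> X\<close>, and
  their intersection contains the one reached with \<open>S\<close>.\<close>

lemma spread_submodular:
  assumes "S \<subseteq> T" "T \<subseteq> C" "X \<subseteq> C"
  shows "f (T \<union> X) + f S \<le> f T + f (S \<union> X)"
proof -
  have sub: "S \<subseteq> C" "T \<union> X \<subseteq> C" "S \<union> X \<subseteq> C" using assms by auto
  have "card (reached L (T \<union> X)) + card (reached L S) \<le> card (reached L T) + card (reached L (S \<union> X))"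
    for L
  proof -
    let ?r = "reached L"
    have ST: "?r S \<subseteq> ?r T" using assms(1) by (rule reached_mono)
    have fin: "finite (?r T)" "finite (?r (S \<union> X))" using assms sub by (auto intro: finite_reached)
    have "?r T \<union> ?r (S \<union> X) = ?r (T \<union> X)"
      using ST by (auto simp: reached_Un assms sub(1))
    moreover have "card (?r S) \<le> card (?r T \<inter> ?r (S \<union> X))"
      using ST reached_mono[of S "S \<union> X" L] fin by (intro card_mono) auto
    ultimately show ?thesis using card_Un_Int[OF fin] by simp
  qed
  then have "real (card (reached L (T \<union> X))) + real (card (reached L S)) \<le>
      real (card (reached L T)) + real (card (reached L (S \<union> X)))" for L
    by (metis of_nat_add of_nat_le_iff)
  then show ?thesis
    unfolding spread_eq[OF sub(1)] spread_eq[OF sub(2)] spread_eq[OF sub(3)] spread_eq[OF assms(2)]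
    unfolding Bochner_Integration.integral_add[OF integrable_live_edges integrable_live_edges, symmetric]
    by (intro integral_mono integrable_live_edges)
qed

text \<open>When \<open>X\<close> is added edge by edge, submodularity bounds each gain by the gain
  over \<open>S\<close>.\<close>

lemma spread_Un_le:
  assumes "S \<subseteq> C" "X \<subseteq> C"
  shows "f (S \<union> X) \<le> f S + (\<Sum>e\<in>X. f (S \<union> {e}) - f S)"
proof -
  have "finite X" using assms(2) finite_C finite_subset by blast
  then show ?thesis using assms(2)
  proof (induction X rule: finite_induct)
    case (insert e X)
    have "f ((S \<union> X) \<union> {e}) + f S \<le> f (S \<union> X) + f (S \<union> {e})"
      using assms(1) insert.prems by (intro spread_submodular) auto
    moreover have "(S \<union> X) \<union> {e} = S \<union> insert e X" by auto
    ultimately show ?case using insert by simp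
  qed simp
qed

lemma \<delta>_eq_gain:
  assumes "S \<subseteq> T" "T \<subseteq> C"
  shows "\<delta> E p A T S = f T - f S"
proof -
  have S: "S \<subseteq> C" using assms by blast
  \<comment> \<open>Candidates avoid \<open>E\<close>, so removing \<open>T - S\<close> deletes no
    original edge.\<close>
  have "L \<inter> (E \<union> T) - (T - S) = L \<inter> (E \<union> S)" for L
    using assms by (auto simp: candidates_def)
  then have "\<delta> E p A T S = measure_pmf.expectation (live_edges p (E \<union> C))
      (\<lambda>L. real (card (reached L T - reached L S)))"
    by (simp add: \<delta>_def expectation_live_edges_subset[OF assms(2)] reached_def)
  also have "(\<lambda>L. real (card (reached L T - reached L S))) =
      (\<lambda>L. real (card (reached L T)) - real (card (reached L S)))"
    using assms S by (simp add: card_Diff_subset reached_mono finite_reached card_mono of_nat_diff)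
  finally show ?thesis
    by (simp add: spread_eq S assms(2) Bochner_Integration.integral_diff integrable_live_edges)
qed

section \<open>The greedy phase\<close>

text \<open>Cross-multiplied, the comparison of ratios stays meaningful at cost \<open>0\<close> and
  can be summed over \<open>x\<close>.\<close>

lemma greedy_choice:
  assumes "is_arg_max (gain_ratio E p c A S) (\<lambda>e. e \<in> T) e" "x \<in> T" "S \<subseteq> C" "T \<subseteq> C"
  shows "(f (S \<union> {x}) - f S) * c e \<le> (f (S \<union> {e}) - f S) * c x"
proof -
  have e: "e \<in> C" "x \<in> C" using assms by (auto simp: is_arg_max_def)
  have gain: "\<delta> E p A (S \<union> {x}) S = f (S \<union> {x}) - f S" "0 \<le> f (S \<union> {x}) - f S" if "x \<in> C" for x
    using that assms(3) \<delta>_eq_gain[of S "S \<union> {x}"] spread_mono[of S "S \<union> {x}"] by auto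
  have "gain_ratio E p c A S x \<le> gain_ratio E p c A S e"
    using assms(1,2) unfolding is_arg_max_linorder by blast
  then have ratio: "ereal (f (S \<union> {x}) - f S) / ereal (c x) \<le> ereal (f (S \<union> {e}) - f S) / ereal (c e)"
    unfolding gain_ratio_def gain(1)[OF e(1)] gain(1)[OF e(2)] .
  show ?thesis
  proof (cases "c e = 0")
    case True
    then show ?thesis using gain(2)[OF e(1)] cost_nonneg[OF e(2)] by simp
  next
    case False
    then have ce: "c e > 0" using cost_nonneg[OF e(1)] by simp
    show ?thesis
    proof (cases "c x = 0")
      case True
      \<comment> \<open>A positive gain at cost \<open>0\<close> would have ratio
        \<open>\<infinity>\<close>, exceeding the finite ratio of \<open>e\<close>.\<close>
      have "f (S \<union> {x}) - f S = 0"
      proof (rule ccontr)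
        assume "f (S \<union> {x}) - f S \<noteq> 0"
        then have "f (S \<union> {x}) - f S > 0" using gain(2)[OF e(2)] by simp
        then show False using ratio ce True by (simp add: divide_ereal_def)
      qed
      then show ?thesis using True by simp
    next
      case False
      then have "c x > 0" using cost_nonneg[OF e(2)] by simp
      then show ?thesis using ratio ce by (simp add: field_simps)
    qed
  qed
qed

text \<open>The deficit to any affordable \<open>Q\<close> shrinks by the factor
  \<open>1 - c e / k \<le> exp (- c e / k)\<close> whenever the greedy choice \<open>e\<close> is added, whether or not
  \<open>e\<close> still fits into the budget.\<close>

lemma greedy_step_deficit:
  assumes "is_arg_max (gain_ratio E p c A S) (\<lambda>e. e \<in> T) e" "S \<subseteq> C" "T \<subseteq> C"
    and Q: "feasible V E c A k Q" "Q - S \<subseteq> T"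
    and "c e \<le> k" "e \<notin> S"
    and deficit: "f Q - f S \<le> exp (- sum c S / k) * f Q"
  shows "f Q - f (S \<union> {e}) \<le> exp (- sum c (S \<union> {e}) / k) * f Q"
proof -
  have e: "e \<in> C" using assms by (auto simp: is_arg_max_def)
  have QC: "Q \<subseteq> C" and cQ: "sum c Q \<le> k" using Q by (auto simp: feasible_def)
  have finS: "finite S" using assms(2) finite_C finite_subset by blast
  let ?g = "f (S \<union> {e}) - f S"
  have g: "0 \<le> ?g" using spread_mono[of S "S \<union> {e}"] assms(2) e by auto
  have k: "0 \<le> k" using cost_nonneg[OF e] \<open>c e \<le> k\<close> by simp
  have "f Q \<le> f (S \<union> (Q - S))" using QC assms(2) by (intro spread_mono) auto
  also have "\<dots> \<le> f S + (\<Sum>x\<in>Q - S. f (S \<union> {x}) - f S)"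
    using QC assms(2) by (intro spread_Un_le) auto
  finally have "(f Q - f S) * c e \<le> (\<Sum>x\<in>Q - S. f (S \<union> {x}) - f S) * c e"
    using cost_nonneg[OF e] by (intro mult_right_mono) auto
  also have "\<dots> \<le> (\<Sum>x\<in>Q - S. ?g * c x)"
    unfolding sum_distrib_right using assms(1-3) Q(2) by (intro sum_mono greedy_choice[of S T]) auto
  also have "\<dots> = ?g * sum c (Q - S)" by (simp add: sum_distrib_left)
  also have "sum c (Q - S) \<le> sum c Q"
    using QC finite_subset[OF QC finite_C] cost_nonneg by (intro sum_mono2) auto
  then have "?g * sum c (Q - S) \<le> ?g * k" using cQ g by (intro mult_left_mono) auto
  finally have main: "(f Q - f S) * c e \<le> ?g * k" .
  have exp_sum: "exp (- sum c (S \<union> {e}) / k) = exp (- c e / k) * exp (- sum c S / k)"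
    using finS \<open>e \<notin> S\<close> by (simp add: exp_add[symmetric] add_divide_distrib diff_divide_distrib)
  have rate: "f Q - f (S \<union> {e}) \<le> (1 - c e / k) * (f Q - f S)"
  \<comment> \<open>For \<open>k = 0\<close> division yields \<open>c e / k = 0\<close>, and the
    claim is mere monotonicity.\<close>
  proof (cases "k = 0")
    case False
    then have "(f Q - f S) * c e / k \<le> ?g" using main k by (simp add: field_simps)
    then show ?thesis by (simp add: algebra_simps diff_divide_distrib)
  qed (use g in simp)
  \<comment> \<open>A nonnegative factor lets the deficit bound be multiplied through even if
    \<open>f Q - f S\<close> is negative.\<close>
  have "1 - c e / k \<ge> 0" using \<open>c e \<le> k\<close> k by (cases "k = 0") auto
  then have "(1 - c e / k) * (f Q - f S) \<le> (1 - c e / k) * (exp (- sum c S / k) * f Q)"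
    using deficit by (intro mult_left_mono) auto
  also have "\<dots> \<le> exp (- c e / k) * (exp (- sum c S / k) * f Q)"
    using exp_ge_add_one_self[of "- c e / k"] spread_nonneg[OF QC] by (intro mult_right_mono) auto
  finally show ?thesis using rate exp_sum by simp
qed

text \<open>Each step preserves \<open>sum c S + b\<close>, and \<open>b\<close> never becomes
  negative.\<close>

lemma greedy_result:
  assumes "greedy E p c A S b T R" "T \<subseteq> C" "S \<inter> T = {}" "finite S" "0 \<le> b"
  shows "S \<subseteq> R \<and> R \<subseteq> S \<union> T \<and> sum c R \<le> sum c S + b"
  using assms
proof (induction rule: greedy.induct)
  case (add S T e b R)
  then have "e \<in> T" by (auto simp: is_arg_max_def)
  moreover have "S \<union> {e} \<subseteq> R \<and> R \<subseteq> S \<union> {e} \<union> (T - {e}) \<and> sum c R \<le> sum c (S \<union> {e}) + (b - c e)"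
    using add by (intro add.IH) auto
  moreover have "sum c (S \<union> {e}) = sum c S + c e"
    using \<open>e \<in> T\<close> add.prems by (subst sum.union_disjoint) auto
  ultimately show ?case by auto
next
  case (skip S T e b R)
  have "S \<subseteq> R \<and> R \<subseteq> S \<union> (T - {e}) \<and> sum c R \<le> sum c S + b"
    using skip by (intro skip.IH) auto
  then show ?case by auto
qed simp

text \<open>Keeps a claim about all runs from being vacuous: a finite nonempty \<open>T\<close> has
  a maximizer, and each step shrinks \<open>T\<close>.\<close>

lemma greedy_exists:
  assumes "finite T"
  shows "\<exists>R. greedy E p c A S b T R"
  using assms
proof (induction "card T" arbitrary: S b T)
  case 0
  then show ?case by (auto intro: greedy.finish)
next
  case (Suc n)
  then have "T \<noteq> {}" by auto
  then obtain e where e: "is_arg_max (gain_ratio E p c A S) (\<lambda>e. e \<in> T) e"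
    using ex_is_arg_max_if_finite[OF Suc.prems] by blast
  then have "n = card (T - {e})" using Suc by (auto simp: is_arg_max_def)
  then show ?case
    using Suc.hyps(1)[of "T - {e}"] Suc.prems greedy.add[OF e] greedy.skip[OF e]
    by (metis finite_Diff)
qed

text \<open>The bound comes from the first element of \<open>Q\<close> that does not fit into the budget: adding it
  to the current solution overshoots the budget, so the deficit has shrunk to \<open>f Q / e\<close>, while by
  submodularity it contributes at most its own spread.\<close>

lemma greedy_plus_single_bound:
  assumes "greedy E p c A S b T R" "S \<subseteq> C" "T \<subseteq> C" "S \<inter> T = {}" "0 \<le> b" "sum c S + b = k"
    and "\<And>e. e \<in> C \<Longrightarrow> f {e} \<le> M" "\<And>e. e \<in> C \<Longrightarrow> c e \<le> k" "0 \<le> M"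
    and "feasible V E c A k Q" "Q - S \<subseteq> T"
    and "f Q - f S \<le> exp (- sum c S / k) * f Q"
  shows "(1 - 1 / exp 1) * f Q \<le> f R + M"
  using assms
proof (induction rule: greedy.induct)
  case (finish S b)
  \<comment> \<open>No edge remains, so \<open>Q - S \<subseteq> T\<close> forces
    \<open>Q \<subseteq> S\<close>.\<close>
  then have "f Q \<le> f S" "0 \<le> f Q"
    by (auto simp: feasible_def intro!: spread_mono spread_nonneg)
  then have "(1 - 1 / exp 1) * f Q \<le> f S"
    by (smt (verit) mult_left_le_one_le exp_gt_zero divide_le_eq_1 exp_ge_add_one_self
        zero_le_divide_iff)
  then show ?case using finish by simp
next
  case (add S T e b R)
  then have e: "e \<in> T" "e \<in> C" "e \<notin> S" by (auto simp: is_arg_max_def)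
  have "finite S" using add.prems(1) finite_C finite_subset by blast
  then have "sum c (S \<union> {e}) = sum c S + c e"
    using e by (simp add: add.commute)
  moreover have "f Q - f (S \<union> {e}) \<le> exp (- sum c (S \<union> {e}) / k) * f Q"
    using add e by (intro greedy_step_deficit) auto
  ultimately show ?case
    using add.prems e add.hyps(2) by (intro add.IH) auto
next
  case (skip S T e b R)
  then have e: "e \<in> T" "e \<in> C" "e \<notin> S" by (auto simp: is_arg_max_def)
  have finS: "finite S" using skip.prems(1) finite_C finite_subset by blast
  show ?case
  proof (cases "e \<in> Q")
    case False
    \<comment> \<open>Discarding an edge outside \<open>Q\<close> keeps
      \<open>Q - S \<subseteq> T\<close>.\<close>
    then show ?thesis using skip.prems by (intro skip.IH) auto
  next
    case True
    have Q0: "0 \<le> f Q" using skip.prems by (auto simp: feasible_def intro: spread_nonneg)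
    have "k > 0" using skip.prems(4) skip.prems(7)[OF e(2)] skip.hyps(2) by simp
    have "sum c (S \<union> {e}) = sum c S + c e" using e finS by (simp add: add.commute)
    then have "sum c (S \<union> {e}) \<ge> k" using skip by simp
    then have "exp (- sum c (S \<union> {e}) / k) \<le> exp (- 1)"
      using \<open>k > 0\<close> by (simp add: field_simps)
    then have "exp (- sum c (S \<union> {e}) / k) * f Q \<le> exp (- 1) * f Q"
      using Q0 by (rule mult_right_mono)
    moreover have "f Q - f (S \<union> {e}) \<le> exp (- sum c (S \<union> {e}) / k) * f Q"
      using skip e by (intro greedy_step_deficit) auto
    ultimately have "f Q - f (S \<union> {e}) \<le> exp (- 1) * f Q" by linarith
    then have "(1 - 1 / exp 1) * f Q \<le> f (S \<union> {e})"
      by (simp add: exp_minus field_simps)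
    \<comment> \<open>Subadditivity: submodularity over the empty set, with
      \<open>f {} \<ge> 0\<close>.\<close>
    also have "f (S \<union> {e}) \<le> f S + f {e}"
      using spread_submodular[of "{}" S "{e}"] spread_nonneg[of "{}"] skip.prems(1) e by simp
    also have "f S \<le> f R"
      using greedy_result[OF skip.hyps(3)] skip.prems finS by (intro spread_mono) auto
    finally show ?thesis using skip.prems(6)[OF e(2)] by simp
  qed
qed

end

text \<open>That each candidate alone fits the budget makes \<open>{e\<^sub>M}\<close> feasible and
  supplies \<open>c e \<le> k\<close> for the deficit estimate. The bound covers every way of
  breaking ties.\<close>

theorem theorem9:
  fixes V :: "'a set" and E :: "('a \<times> 'a) set" and p c :: "'a \<times> 'a \<Rightarrow> real"
    and A :: "'a set" and k :: real
  assumes "network V E p c"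
    and "A \<subseteq> V"
    and "0 \<le> k"
    and "\<forall>e \<in> candidates V E A. c e \<le> k"
  shows "(\<exists>S\<^sub>o\<^sub>u\<^sub>t. algorithm_returns V E p c A k S\<^sub>o\<^sub>u\<^sub>t) \<and>
         (\<forall>S\<^sub>o\<^sub>u\<^sub>t. algorithm_returns V E p c A k S\<^sub>o\<^sub>u\<^sub>t \<longrightarrow>
            feasible V E c A k S\<^sub>o\<^sub>u\<^sub>t \<and>
            \<sigma> E p A S\<^sub>o\<^sub>u\<^sub>t \<ge> 1 / 2 * (1 - 1 / exp 1) * OPT V E p c A k)"
proof -
  interpret augmentation_instance V E p c A
    using assms(1,2) by unfold_locales
  show ?thesis
  proof (intro conjI allI impI)
    obtain R where R: "greedy E p c A {} k C R" using greedy_exists[OF finite_C] by blast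
    show "\<exists>S\<^sub>o\<^sub>u\<^sub>t. algorithm_returns V E p c A k S\<^sub>o\<^sub>u\<^sub>t"
    proof (cases "C = {}")
      case True
      then show ?thesis using R by (auto simp: algorithm_returns_def)
    next
      case False
      then obtain e where "is_arg_max (\<lambda>e. f {e}) (\<lambda>e. e \<in> C) e"
        using ex_is_arg_max_if_finite[OF finite_C] by blast
      moreover obtain X where "is_arg_max f (\<lambda>X. X \<in> {R, {e}}) X"
        using ex_is_arg_max_if_finite[of "{R, {e}}" f] by blast
      ultimately show ?thesis using R False unfolding algorithm_returns_def by metis
    qed
  next
    fix X assume X: "algorithm_returns V E p c A k X"
    then obtain R where R: "greedy E p c A {} k C R"
      and out: "if C = {} then X = R else \<exists>e. is_arg_max (\<lambda>e. f {e}) (\<lambda>e. e \<in> C) e \<and>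
        is_arg_max f (\<lambda>X. X \<in> {R, {e}}) X"
      unfolding algorithm_returns_def by blast
    have feasR: "feasible V E c A k R"
      using greedy_result[OF R] assms(3) by (auto simp: feasible_def)
    have X: "feasible V E c A k X \<and> f R \<le> f X \<and> (\<forall>e\<in>C. f {e} \<le> f X)"
    proof (cases "C = {}")
      case False
      then obtain e where "is_arg_max (\<lambda>e. f {e}) (\<lambda>e. e \<in> C) e" "is_arg_max f (\<lambda>X. X \<in> {R, {e}}) X"
        using out by auto
      then have e: "e \<in> C" "\<forall>e'\<in>C. f {e'} \<le> f {e}" "f R \<le> f X" "f {e} \<le> f X" "X \<in> {R, {e}}"
        by (auto simp: is_arg_max_linorder)
      then have "feasible V E c A k X"
        using feasR assms(4) by (auto simp: feasible_def)
      then show ?thesis using e by force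
    qed (use out feasR in auto)
    then show "feasible V E c A k X" by blast
    have "finite {S. feasible V E c A k S}"
      by (rule finite_subset[of _ "Pow C"]) (auto simp: feasible_def finite_C)
    moreover have "feasible V E c A k {}" using assms(3) by (simp add: feasible_def)
    ultimately have "OPT V E p c A k \<in> f ` {S. feasible V E c A k S}"
      unfolding OPT_def by (intro Max_in) auto
    then obtain Q where Q: "feasible V E c A k Q" "OPT V E p c A k = f Q" by auto
    \<comment> \<open>The returned \<open>X\<close> dominates every single edge, so
      \<open>f X\<close> serves as \<open>M\<close>; as it also dominates \<open>R\<close>, the
      factor \<open>1 / 2\<close> follows.\<close>
    have "(1 - 1 / exp 1) * f Q \<le> f R + f X"
    proof (rule greedy_plus_single_bound[OF R])
      show "Q - {} \<subseteq> C" "0 \<le> f X"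
        using Q X by (auto simp: feasible_def intro: spread_nonneg)
      show "f Q - f {} \<le> exp (- sum c {} / k) * f Q" using spread_nonneg[of "{}"] by simp
    qed (use Q X assms in auto)
    then have "(1 - 1 / exp 1) * f Q \<le> 2 * f X" using X by linarith
    then show "1 / 2 * (1 - 1 / exp 1) * OPT V E p c A k \<le> f X"
      using Q(2) by simp
  qed
qed

end
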